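(* Let $m\ge 2$ and $n\ge 2$ be integers. The number $A_{m,n}$ of subdivisions of the point configuration $P_{m,n}$ satisfies $$A_{m,n}=2A_{m,n-1}+2A_{m-1,n}-2A_{m-1,n-1}.$$
   Context: For integers $m,n\ge 1$, the point configuration $P_{m,n}\subset\mathbb R^2$ is the two-row grid consisting of the $n$ bottom points $(0,0),(1,0),\dots,(n-1,0)$ and the $m$ top points $(0,1),(1,1),\dots,(m-1,1)$. A subdivision of a finite point configuration $\mathcal A\subset\mathbb R^2$ is a collection of convex polygons (two-dimensional, with nonempty interior, regarded as convex sets) whose vertices lie in $\mathcal A$, such that the union of the polygons is the convex hull of $\mathcal A$ and each pair of distinct polygons either does not intersect or intersects exactly in a common vertex or a common side. Not all points of $\mathcal A$ need to be vertices of polygons. $A_{m,n}$ denotes the number of subdivisions of $P_{m,n}$, with the convention $A_{1,1}=\tfrac12$ for the degenerate configuration $P_{1,1}$. *)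

theory Defs
  imports "HOL-Analysis.Polytope"
begin

definition convex_polygon :: "(real \<times> real) set \<Rightarrow> bool" where
  "convex_polygon P \<longleftrightarrow> polytope P \<and> interior P \<noteq> {}"

definition polygon_vertices :: "(real \<times> real) set \<Rightarrow> (real \<times> real) set" where
  "polygon_vertices P = {v. v extreme_point_of P}"

text \<open>
  Polygons are plain convex sets: points of the configuration lying on a polygon without being
  extreme points of it are not recorded.
\<close>

definition meet_properly :: "(real \<times> real) set \<Rightarrow> (real \<times> real) set \<Rightarrow> bool" where
  "meet_properly P Q \<longleftrightarrow>
     P \<inter> Q = {} \<or>
     (\<exists>v. v \<in> polygon_vertices P \<and> v \<in> polygon_vertices Q \<and> P \<inter> Q = {v}) \<or>
     (\<exists>e. e edge_of P \<and> e edge_of Q \<and> P \<inter> Q = e)"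

definition is_subdivision :: "(real \<times> real) set \<Rightarrow> (real \<times> real) set set \<Rightarrow> bool" where
  "is_subdivision \<A> \<S> \<longleftrightarrow>
     (\<forall>P\<in>\<S>. convex_polygon P \<and> polygon_vertices P \<subseteq> \<A>) \<and>
     \<Union>\<S> = convex hull \<A> \<and>
     (\<forall>P\<in>\<S>. \<forall>Q\<in>\<S>. P \<noteq> Q \<longrightarrow> meet_properly P Q)"

definition two_row_grid :: "nat \<Rightarrow> nat \<Rightarrow> (real \<times> real) set" where
  "two_row_grid m n = (\<lambda>i. (real i, 0)) ` {..<n} \<union> (\<lambda>j. (real j, 1)) ` {..<m}"

text \<open>
  The configuration with one point in each row spans only a segment and has no subdivision; its
  count is set to one half by convention, so the counting function takes real values.
\<close>

definition num_subdivisions :: "nat \<Rightarrow> nat \<Rightarrow> real" where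
  "num_subdivisions m n =
     (if m = 1 \<and> n = 1 then 1 / 2
      else real (card {\<S>. is_subdivision (two_row_grid m n) \<S>}))"

text \<open>
  A finite configuration has only finitely many subdivisions, so the cardinality above is a
  genuine count.
\<close>

lemma finite_subdivisions:
  assumes "finite \<A>"
  shows "finite {\<S>. is_subdivision \<A> \<S>}"
proof (rule finite_subset)
  show "{\<S>. is_subdivision \<A> \<S>} \<subseteq> Pow ((hull) convex ` Pow \<A>)"
  proof clarify
    fix \<S> P assume "is_subdivision \<A> \<S>" "P \<in> \<S>"
    then have "polytope P" and sub: "polygon_vertices P \<subseteq> \<A>"
      by (auto simp: is_subdivision_def convex_polygon_def)
    then have "P = convex hull (polygon_vertices P)"
      unfolding polygon_vertices_def
      by (intro Krein_Milman_Minkowski polytope_imp_compact polytope_imp_convex)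
    with sub show "P \<in> (hull) convex ` Pow \<A>" by blast
  qed
  show "finite (Pow ((hull) convex ` Pow \<A>))" using assms by simp
qed

lemma finite_two_row_grid: "finite (two_row_grid m n)"
  by (simp add: two_row_grid_def)

end

theory Submission imports Defs begin

text \<open>
  A polygon with vertices in the grid is a (possibly degenerate) trapezoid bounded by two segments
  that join the rows, so a subdivision amounts to a chain from $(0,0)$ to $(p,q) = (n-1,m-1)$ in the
  product order. Removing the last polygon gives, for the number $f(p,q)$ of subdivisions, that
  $f(p,q)$ is the sum of $f(i,j)$ over all $(i,j) < (p,q)$; here $f(0,0) = 1$ counts the empty
  family. Hence the full rectangular sum of $f$ up to $(p,q)$ is $2 A_{m,n}$, also in the degenerate
  case thanks to $A_{1,1} = 1/2$, and inclusion-exclusion for these sums is the recurrence.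
\<close>

section \<open>Trapezoids spanned between the two rows\<close>

text \<open>The abscissa at height \<open>y\<close> of the segment from \<open>(a, 0)\<close> to
  \<open>(c, 1)\<close>. The pair \<open>(a, c)\<close> encodes that segment, and the componentwise
  order on pairs means "weakly to the left".\<close>

definition crossing :: "nat \<Rightarrow> nat \<Rightarrow> real \<Rightarrow> real" where
  "crossing a c y = (1 - y) * real a + y * real c"

text \<open>
  The trapezoid over $[a,b]$ in the bottom row and $[c,d]$ in the top row; for $(a,c) = (b,d)$ it is
  a single segment between the rows.
\<close>

definition cell :: "nat \<Rightarrow> nat \<Rightarrow> nat \<Rightarrow> nat \<Rightarrow> (real \<times> real) set" where
  "cell a c b d = {(x, y). 0 \<le> y \<and> y \<le> 1 \<and> crossing a c y \<le> x \<and> x \<le> crossing b d y}"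

lemma mem_cell:
  "(x, y) \<in> cell a c b d \<longleftrightarrow> 0 \<le> y \<and> y \<le> 1 \<and> crossing a c y \<le> x \<and> x \<le> crossing b d y"
  by (simp add: cell_def)

lemma crossing_ends [simp]: "crossing a c 0 = real a" "crossing a c 1 = real c"
  by (simp_all add: crossing_def)

lemma crossing_mono:
  assumes "0 \<le> y" "y \<le> 1" "a \<le> b" "c \<le> d"
  shows "crossing a c y \<le> crossing b d y"
  unfolding crossing_def using assms by (intro add_mono mult_left_mono) auto

text \<open>Distinct comparable segments may share an endpoint, but strictly between the rows both
  weights are positive, so a strict inequality at either end survives.\<close>

lemma crossing_strict_mono:
  assumes "0 < y" "y < 1" "a \<le> b" "c \<le> d" "(a, c) \<noteq> (b, d)"
  shows "crossing a c y < crossing b d y"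
proof (cases "a = b")
  case True
  then have "c < d" using assms by auto
  then show ?thesis using assms True by (simp add: crossing_def)
next
  case False
  then have "(1 - y) * real a < (1 - y) * real b" using assms by simp
  moreover have "y * real c \<le> y * real d" using assms by simp
  ultimately show ?thesis unfolding crossing_def by linarith
qed

text \<open>Inequalities are convenient for membership and intersections, the hull for polytopes and
  extreme points. A point of the cell divides its horizontal chord in a ratio \<open>t\<close>;
  dividing the bottom and top sides in the same ratio and joining the results reaches it.
  Conversely, the cell is an intersection of four half-planes.\<close>

lemma cell_eq_hull:
  assumes "a \<le> b" "c \<le> d"
  shows "cell a c b d =
    convex hull {(real a, 0), (real b, 0), (real c, 1), (real d, 1)}" (is "_ = convex hull ?V")
proof
  show "cell a c b d \<subseteq> convex hull ?V"
  proof clarify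
    fix x y assume "(x, y) \<in> cell a c b d"
    then have y: "0 \<le> y" "y \<le> 1" and x: "crossing a c y \<le> x" "x \<le> crossing b d y"
      by (auto simp: mem_cell)
    then have "x \<in> closed_segment (crossing a c y) (crossing b d y)"
      by (simp add: closed_segment_eq_real_ivl)
    then obtain t where t: "0 \<le> t" "t \<le> 1"
      and xt: "x = (1 - t) * crossing a c y + t * crossing b d y"
      by (auto simp: in_segment)
    have cvx: "convex (convex hull ?V)" by simp
    have V: "?V \<subseteq> convex hull ?V" by (rule hull_subset)
    have 0: "(1 - t) *\<^sub>R (real a, 0::real) + t *\<^sub>R (real b, 0) \<in> convex hull ?V"
      using V t by (intro convexD[OF cvx]) auto
    have 1: "(1 - t) *\<^sub>R (real c, 1::real) + t *\<^sub>R (real d, 1) \<in> convex hull ?V"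
      using V t by (intro convexD[OF cvx]) auto
    have "(1 - y) *\<^sub>R ((1 - t) *\<^sub>R (real a, 0::real) + t *\<^sub>R (real b, 0))
        + y *\<^sub>R ((1 - t) *\<^sub>R (real c, 1::real) + t *\<^sub>R (real d, 1)) \<in> convex hull ?V"
      using y by (intro convexD[OF cvx 0 1]) auto
    also have "(1 - y) *\<^sub>R ((1 - t) *\<^sub>R (real a, 0::real) + t *\<^sub>R (real b, 0))
        + y *\<^sub>R ((1 - t) *\<^sub>R (real c, 1::real) + t *\<^sub>R (real d, 1)) = (x, y)"
      by (simp add: xt crossing_def algebra_simps)
    finally show "(x, y) \<in> convex hull ?V" .
  qed
  have "cell a c b d =
      {z. (0, -1) \<bullet> z \<le> 0} \<inter> {z. (0, 1) \<bullet> z \<le> 1} \<inter>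
      {z. (-1, real c - real a) \<bullet> z \<le> - real a} \<inter> {z. (1, real b - real d) \<bullet> z \<le> real b}"
    by (auto simp: cell_def crossing_def algebra_simps)
  then have "convex (cell a c b d)"
    by (simp only:) (intro convex_Int convex_halfspace_le)
  then show "convex hull ?V \<subseteq> cell a c b d"
    using assms by (intro hull_minimal) (auto simp: mem_cell)
qed

lemma cell_eq_segment: "cell a c a c = closed_segment (real a, 0) (real c, 1)"
  by (simp add: cell_eq_hull segment_convex_hull)

lemma polytope_cell: "a \<le> b \<Longrightarrow> c \<le> d \<Longrightarrow> polytope (cell a c b d)"
  by (simp add: cell_eq_hull polytope_convex_hull)

lemma convex_cell: "a \<le> b \<Longrightarrow> c \<le> d \<Longrightarrow> convex (cell a c b d)"
  by (simp add: cell_eq_hull)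

lemma interior_cell_memI:
  assumes "0 < y" "y < 1" "crossing a c y < x" "x < crossing b d y"
  shows "(x, y) \<in> interior (cell a c b d)"
proof -
  let ?O = "{z. 0 < snd z} \<inter> {z. snd z < 1} \<inter> {z. crossing a c (snd z) < fst z}
    \<inter> {z. fst z < crossing b d (snd z)}"
  have "open ?O"
    unfolding crossing_def by (intro open_Int open_Collect_less continuous_intros)
  moreover have "?O \<subseteq> cell a c b d" by (auto simp: mem_cell)
  moreover have "(x, y) \<in> ?O" using assms by simp
  ultimately show ?thesis by (meson interior_maximal subsetD)
qed

lemma convex_polygon_cell:
  assumes "a \<le> b" "c \<le> d" "(a, c) \<noteq> (b, d)"
  shows "convex_polygon (cell a c b d)"
proof -
  have "crossing a c (1/2) < crossing b d (1/2)"
    using assms by (intro crossing_strict_mono) auto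
  then have "((crossing a c (1/2) + crossing b d (1/2)) / 2, 1/2) \<in> interior (cell a c b d)"
    by (intro interior_cell_memI) auto
  then show ?thesis
    using assms by (auto simp: convex_polygon_def polytope_cell)
qed

text \<open>Containment is decided at the four corners; in particular a cell determines its
  parameters.\<close>

lemma cell_subset_iff:
  assumes "a \<le> b" "c \<le> d" "a' \<le> b'" "c' \<le> d'"
  shows "cell a c b d \<subseteq> cell a' c' b' d' \<longleftrightarrow> a' \<le> a \<and> c' \<le> c \<and> b \<le> b' \<and> d \<le> d'"
proof
  assume *: "cell a c b d \<subseteq> cell a' c' b' d'"
  have "(real a, 0) \<in> cell a c b d" "(real b, 0) \<in> cell a c b d"
    "(real c, 1) \<in> cell a c b d" "(real d, 1) \<in> cell a c b d"
    using assms by (auto simp: mem_cell)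
  with * have "(real a, 0) \<in> cell a' c' b' d'" "(real b, 0) \<in> cell a' c' b' d'"
    "(real c, 1) \<in> cell a' c' b' d'" "(real d, 1) \<in> cell a' c' b' d'"
    by blast+
  then show "a' \<le> a \<and> c' \<le> c \<and> b \<le> b' \<and> d \<le> d'" by (auto simp: mem_cell)
next
  assume "a' \<le> a \<and> c' \<le> c \<and> b \<le> b' \<and> d \<le> d'"
  then show "cell a c b d \<subseteq> cell a' c' b' d'"
    by (auto simp: mem_cell) (meson crossing_mono order_trans)+
qed

section \<open>Polygons with vertices in the grid\<close>

lemma mem_two_row_grid:
  "z \<in> two_row_grid (Suc q) (Suc p) \<longleftrightarrow>
    (\<exists>i\<le>p. z = (real i, 0)) \<or> (\<exists>j\<le>q. z = (real j, 1))"
  by (auto simp: two_row_grid_def less_Suc_eq_le)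

lemma convex_hull_two_row_grid:
  "convex hull (two_row_grid (Suc q) (Suc p)) = cell 0 0 p q"
proof
  show "convex hull (two_row_grid (Suc q) (Suc p)) \<subseteq> cell 0 0 p q"
    by (intro hull_minimal convex_cell subsetI) (auto simp: mem_two_row_grid mem_cell)
  have "{(real 0, 0), (real p, 0), (real 0, 1), (real q, 1)} \<subseteq> two_row_grid (Suc q) (Suc p)"
    by (simp add: mem_two_row_grid)
  then show "cell 0 0 p q \<subseteq> convex hull (two_row_grid (Suc q) (Suc p))"
    by (metis cell_eq_hull hull_mono zero_le)
qed

definition cells :: "nat \<Rightarrow> nat \<Rightarrow> (real \<times> real) set set" where
  "cells p q = {cell a c b d | a c b d. a \<le> b \<and> b \<le> p \<and> c \<le> d \<and> d \<le> q \<and> (a, c) \<noteq> (b, d)}"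

lemma cellsE:
  assumes "P \<in> cells p q"
  obtains a c b d where "P = cell a c b d" "a \<le> b" "b \<le> p" "c \<le> d" "d \<le> q" "(a, c) \<noteq> (b, d)"
  using assms unfolding cells_def by blast

lemma cellsI:
  "a \<le> b \<Longrightarrow> b \<le> p \<Longrightarrow> c \<le> d \<Longrightarrow> d \<le> q \<Longrightarrow> (a, c) \<noteq> (b, d) \<Longrightarrow> cell a c b d \<in> cells p q"
  unfolding cells_def by blast

lemma cells_mono: "p \<le> p' \<Longrightarrow> q \<le> q' \<Longrightarrow> cells p q \<subseteq> cells p' q'"
  by (force elim!: cellsE intro: cellsI)

lemma finite_cells: "finite (cells p q)"
proof (rule finite_subset)
  show "cells p q \<subseteq> (\<lambda>(a, c, b, d). cell a c b d) ` ({..p} \<times> {..q} \<times> {..p} \<times> {..q})"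
    by (force elim!: cellsE)
qed auto

lemma interior_hyperplane_subset:
  fixes P :: "(real \<times> real) set"
  assumes "u \<noteq> 0" "P \<subseteq> {z. u \<bullet> z = k}"
  shows "interior P = {}"
  using interior_mono[OF assms(2)] interior_hyperplane[OF assms(1)] by auto

text \<open>A polygon is the hull of its extreme points. Nonempty interior forces extreme points in
  both rows, and within a row only the leftmost and rightmost ones affect the hull.\<close>

lemma polygon_iff_cells:
  "convex_polygon P \<and> polygon_vertices P \<subseteq> two_row_grid (Suc q) (Suc p) \<longleftrightarrow> P \<in> cells p q"
proof
  assume "P \<in> cells p q"
  then obtain a c b d where P: "P = cell a c b d"
    and *: "a \<le> b" "b \<le> p" "c \<le> d" "d \<le> q" "(a, c) \<noteq> (b, d)" by (rule cellsE)
  have "polygon_vertices P \<subseteq> {(real a, 0), (real b, 0), (real c, 1), (real d, 1)}"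
    unfolding polygon_vertices_def P cell_eq_hull[OF *(1,3)]
    using extreme_point_of_convex_hull by blast
  also have "\<dots> \<subseteq> two_row_grid (Suc q) (Suc p)"
    using * by (auto simp: mem_two_row_grid)
  finally show "convex_polygon P \<and> polygon_vertices P \<subseteq> two_row_grid (Suc q) (Suc p)"
    using * convex_polygon_cell P by blast
next
  assume "convex_polygon P \<and> polygon_vertices P \<subseteq> two_row_grid (Suc q) (Suc p)"
  then have poly: "polytope P" and int: "interior P \<noteq> {}"
    and sub: "polygon_vertices P \<subseteq> two_row_grid (Suc q) (Suc p)"
    by (auto simp: convex_polygon_def)
  define V where "V = polygon_vertices P"
  have P: "P = convex hull V"
    unfolding V_def polygon_vertices_def
    using poly by (intro Krein_Milman_Minkowski polytope_imp_compact polytope_imp_convex)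
  define B where "B = {i. (real i, 0) \<in> V}"
  define T where "T = {j. (real j, 1) \<in> V}"
  have B: "B \<subseteq> {..p}" and T: "T \<subseteq> {..q}"
    using sub by (auto simp: B_def T_def V_def mem_two_row_grid)
  have fin: "finite B" "finite T" using B T by (auto intro: finite_subset)
  have V: "z \<in> V \<Longrightarrow> (\<exists>i\<in>B. z = (real i, 0)) \<or> (\<exists>j\<in>T. z = (real j, 1))" for z
  proof -
    assume "z \<in> V"
    then have "z \<in> two_row_grid (Suc q) (Suc p)" using sub by (auto simp: V_def)
    then show ?thesis using \<open>z \<in> V\<close> by (auto simp: mem_two_row_grid B_def T_def)
  qed
  have "B \<noteq> {}"
  proof
    assume "B = {}"
    then have "V \<subseteq> {z. (0, 1) \<bullet> z = 1}" using V by fastforce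
    then have "P \<subseteq> {z. (0, 1) \<bullet> z = 1}"
      unfolding P by (intro hull_minimal convex_hyperplane)
    then have "interior P = {}" by (rule interior_hyperplane_subset[rotated]) (simp add: zero_prod_def)
    with int show False by blast
  qed
  have "T \<noteq> {}"
  proof
    assume "T = {}"
    then have "V \<subseteq> {z. (0, 1) \<bullet> z = 0}" using V by fastforce
    then have "P \<subseteq> {z. (0, 1) \<bullet> z = 0}"
      unfolding P by (intro hull_minimal convex_hyperplane)
    then have "interior P = {}" by (rule interior_hyperplane_subset[rotated]) (simp add: zero_prod_def)
    with int show False by blast
  qed
  define a b c d where "a = Min B" and "b = Max B" and "c = Min T" and "d = Max T"
  have mem: "a \<in> B" "b \<in> B" "c \<in> T" "d \<in> T"
    using fin \<open>B \<noteq> {}\<close> \<open>T \<noteq> {}\<close> by (auto simp: a_def b_def c_def d_def)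
  have bnd: "i \<in> B \<Longrightarrow> a \<le> i \<and> i \<le> b" "j \<in> T \<Longrightarrow> c \<le> j \<and> j \<le> d" for i j
    using fin by (auto simp: a_def b_def c_def d_def)
  have ab: "a \<le> b" "c \<le> d" using mem bnd by blast+
  have Pc: "P = cell a c b d"
  proof
    have "{(real a, 0), (real b, 0), (real c, 1), (real d, 1)} \<subseteq> V"
      using mem by (simp add: B_def T_def)
    then show "cell a c b d \<subseteq> P"
      unfolding P cell_eq_hull[OF ab] by (rule hull_mono)
    show "P \<subseteq> cell a c b d"
      unfolding P using V bnd
      by (intro hull_minimal convex_cell ab subsetI) (fastforce simp: mem_cell)
  qed
  have "(a, c) \<noteq> (b, d)"
  proof
    assume "(a, c) = (b, d)"
    \<comment> \<open>The hyperplane is the line through \<open>(a, 0)\<close> and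
      \<open>(c, 1)\<close>.\<close>
    then have "P \<subseteq> {z. (1, real a - real c) \<bullet> z = real a}"
      by (auto simp: Pc mem_cell crossing_def algebra_simps)
    then have "interior P = {}" by (rule interior_hyperplane_subset[rotated]) (simp add: zero_prod_def)
    with int show False by blast
  qed
  then show "P \<in> cells p q"
    unfolding Pc using ab mem B T by (intro cellsI) auto
qed

section \<open>How two trapezoids can meet\<close>

text \<open>If the difference were nonpositive strictly between the rows, continuity would extend
  this to heights 0 and 1, where the difference is \<open>b - i\<close> and
  \<open>d - j\<close>.\<close>

lemma crossing_less_exists:
  assumes "i < b \<or> j < d"
  obtains y where "0 < y" "y < 1" "crossing i j y < crossing b d y"
proof -
  define h where "h y = crossing b d y - crossing i j y" for y
  have cont: "continuous_on {0..1} h"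
    unfolding h_def crossing_def by (intro continuous_intros)
  have "\<exists>y\<in>{0<..<1}. h y > 0"
  proof (rule ccontr)
    assume "\<not> ?thesis"
    then have le: "h y \<le> 0" if "y \<in> {0<..<1}" for y using that by force
    have "h y \<le> 0" if "y \<in> {0..1}" for y
      using continuous_le_on_closure[of "{0<..<1}" h y 0] cont that le by simp
    from this[of 0] this[of 1] assms show False by (auto simp: h_def)
  qed
  then show thesis using that by (auto simp: h_def)
qed

text \<open>A proper intersection is empty, a point or an edge, hence of dimension at most
  one.\<close>

lemma meet_properly_interior:
  assumes "meet_properly P Q"
  shows "interior (P \<inter> Q) = {}"
proof (rule ccontr)
  assume *: "interior (P \<inter> Q) \<noteq> {}"
  then have "aff_dim (P \<inter> Q) = 2" by (simp add: aff_dim_nonempty_interior)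
  moreover have "P \<inter> Q \<noteq> {}" using * by (metis interior_empty)
  ultimately show False
    using assms unfolding meet_properly_def edge_of_def by force
qed

text \<open>The second cell reaches the far right edge, so a first cell protruding past its left
  edge would overlap it in an open set.\<close>

lemma meet_properly_cell_left:
  assumes "a \<le> b" "c \<le> d" "(a, c) \<noteq> (b, d)"
    and "b \<le> p" "d \<le> q" "i \<le> p" "j \<le> q"
    and meet: "meet_properly (cell a c b d) (cell i j p q)"
  shows "b \<le> i \<and> d \<le> j"
proof (rule ccontr)
  assume "\<not> ?thesis"
  then have "i < b \<or> j < d" by auto
  then obtain y where y: "0 < y" "y < 1" and ij: "crossing i j y < crossing b d y"
    by (rule crossing_less_exists)
  \<comment> \<open>The midpoint of the chord common to both cells at height
    \<open>y\<close>.\<close>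
  define x where "x = (max (crossing a c y) (crossing i j y) + crossing b d y) / 2"
  have "crossing a c y < crossing b d y" using y assms by (intro crossing_strict_mono)
  moreover have "crossing b d y \<le> crossing p q y" using y assms by (intro crossing_mono) auto
  ultimately have "(x, y) \<in> interior (cell a c b d) \<inter> interior (cell i j p q)"
    using y ij by (auto intro!: interior_cell_memI simp: x_def)
  then show False using meet_properly_interior[OF meet] by auto
qed

text \<open>Each slanted side is cut out by a supporting line: \<open>x = crossing i j y\<close> is
  the line with normal \<open>(1, i - j)\<close> and offset \<open>i\<close>.\<close>

lemma edge_of_cell:
  assumes "a \<le> b" "c \<le> d" "(a, c) \<noteq> (b, d)"
  shows "cell b d b d edge_of cell a c b d" "cell a c a c edge_of cell a c b d"
proof -
  have dim: "aff_dim (cell i j i j) = 1" for i j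
    by (simp add: cell_eq_segment segment_convex_hull aff_dim_convex_hull aff_dim_2)
  have on_line: "(1, real i - real j) \<bullet> (x, y) = real i \<longleftrightarrow> x = crossing i j y"
    for i j x y by (auto simp: crossing_def algebra_simps)
  have "cell b d b d = cell a c b d \<inter> {z. (1, real b - real d) \<bullet> z = real b}"
    using crossing_mono[of _ a b c d] assms by (auto simp: on_line cell_def simp del: inner_Pair)
  also have "\<dots> face_of cell a c b d"
    using assms by (intro face_of_Int_supporting_hyperplane_le convex_cell)
      (auto simp: cell_def crossing_def algebra_simps)
  finally show "cell b d b d edge_of cell a c b d" using dim by (simp add: edge_of_def)
  have "cell a c a c = cell a c b d \<inter> {z. (1, real a - real c) \<bullet> z = real a}"
    using crossing_mono[of _ a b c d] assms by (auto simp: on_line cell_def simp del: inner_Pair)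
  also have "\<dots> face_of cell a c b d"
    using assms by (intro face_of_Int_supporting_hyperplane_ge convex_cell)
      (auto simp: cell_def crossing_def algebra_simps)
  finally show "cell a c a c edge_of cell a c b d" using dim by (simp add: edge_of_def)
qed

lemma edge_ends_polygon_vertices:
  assumes "cell i j i j edge_of P"
  shows "(real i, 0) \<in> polygon_vertices P" "(real j, 1) \<in> polygon_vertices P"
proof -
  have "cell i j i j face_of P" using assms by (simp add: edge_of_def)
  moreover have "(real i, 0) extreme_point_of cell i j i j" "(real j, 1) extreme_point_of cell i j i j"
    by (simp_all add: cell_eq_segment extreme_point_of_segment)
  ultimately show "(real i, 0) \<in> polygon_vertices P" "(real j, 1) \<in> polygon_vertices P"
    using extreme_point_of_face by (auto simp: polygon_vertices_def)
qed

lemma meet_properly_sym: "meet_properly P Q \<Longrightarrow> meet_properly Q P"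
  by (auto simp: meet_properly_def Int_commute)

text \<open>The right edge of the first cell lies weakly left of the left edge of the second, so the
  cells meet only where these edges do: in a whole edge, a bottom vertex, a top vertex or nowhere,
  according to whether \<open>b = i\<close> and \<open>d = j\<close>.\<close>

lemma meet_properly_cellI:
  assumes "a \<le> b" "c \<le> d" "(a, c) \<noteq> (b, d)"
    and "b \<le> i" "d \<le> j" "i \<le> p" "j \<le> q" "(i, j) \<noteq> (p, q)"
  shows "meet_properly (cell a c b d) (cell i j p q)"
proof -
  let ?P = "cell a c b d" and ?Q = "cell i j p q"
  have E: "cell b d b d edge_of ?P" "cell i j i j edge_of ?Q"
    using assms edge_of_cell by auto
  have eq: "crossing b d y = crossing i j y \<longleftrightarrow> (y = 1 \<or> b = i) \<and> (y = 0 \<or> d = j)"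
    if "0 \<le> y" "y \<le> 1" for y
  proof (cases "y = 0 \<or> y = 1 \<or> (b, d) = (i, j)")
    case False
    then show ?thesis
      using crossing_strict_mono[of y b i d j] assms that by auto
  qed auto
  \<comment> \<open>A common point satisfies
    \<open>x \<le> crossing b d y \<le> crossing i j y \<le> x\<close>, so equality holds
    throughout.\<close>
  have int: "?P \<inter> ?Q = {(x, y). 0 \<le> y \<and> y \<le> 1 \<and> x = crossing i j y \<and>
      (y = 1 \<or> b = i) \<and> (y = 0 \<or> d = j)}" (is "_ = ?R")
  proof (intro equalityI subrelI)
    fix x y assume xy: "(x, y) \<in> ?P \<inter> ?Q"
    then have y: "0 \<le> y" "y \<le> 1" by (simp_all add: mem_cell)
    moreover have "crossing b d y \<le> crossing i j y" using y assms by (intro crossing_mono)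
    ultimately show "(x, y) \<in> ?R" using xy eq[OF y] by (simp add: mem_cell)
  next
    fix x y assume xy: "(x, y) \<in> ?R"
    then have y: "0 \<le> y" "y \<le> 1" by simp_all
    have "crossing a c y \<le> crossing b d y" "crossing i j y \<le> crossing p q y"
      using y assms by (auto intro: crossing_mono)
    then show "(x, y) \<in> ?P \<inter> ?Q" using xy eq[OF y] by (simp add: mem_cell)
  qed
  consider "b = i" "d = j" | "b = i" "d \<noteq> j" | "b \<noteq> i" "d = j" | "b \<noteq> i" "d \<noteq> j" by blast
  then show ?thesis
  proof cases
    case 1
    have "?P \<inter> ?Q = cell i j i j" unfolding int using 1 by (auto simp: cell_def)
    then show ?thesis using E 1 unfolding meet_properly_def by auto
  next
    case 2
    have "?P \<inter> ?Q = {(real i, 0)}" unfolding int using 2 by auto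
    then show ?thesis
      using edge_ends_polygon_vertices(1)[OF E(1)] edge_ends_polygon_vertices(1)[OF E(2)] 2
      unfolding meet_properly_def by blast
  next
    case 3
    have "?P \<inter> ?Q = {(real j, 1)}" unfolding int using 3 by auto
    then show ?thesis
      using edge_ends_polygon_vertices(2)[OF E(1)] edge_ends_polygon_vertices(2)[OF E(2)] 3
      unfolding meet_properly_def by blast
  next
    case 4
    have "?P \<inter> ?Q = {}" unfolding int using 4 by auto
    then show ?thesis by (simp add: meet_properly_def)
  qed
qed

section \<open>Subdivisions as families of trapezoids\<close>

text \<open>
  Adding the right edge \<^term>\<open>cell p q p q\<close> to the union matters only for $p = q = 0$, where it
  makes the empty family the unique member.
\<close>

definition cell_subdivisions :: "nat \<Rightarrow> nat \<Rightarrow> (real \<times> real) set set set" where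
  "cell_subdivisions p q = {\<S>. \<S> \<subseteq> cells p q \<and> \<Union>\<S> \<union> cell p q p q = cell 0 0 p q \<and>
     (\<forall>P\<in>\<S>. \<forall>Q\<in>\<S>. P \<noteq> Q \<longrightarrow> meet_properly P Q)}"

lemma finite_cell_subdivisions: "finite (cell_subdivisions p q)"
  by (rule finite_subset[of _ "Pow (cells p q)"]) (auto simp: cell_subdivisions_def finite_cells)

lemma cell_subdivisions_0: "cell_subdivisions 0 0 = {{}}"
proof -
  have "cells 0 0 = {}" by (auto elim: cellsE)
  then show ?thesis by (auto simp: cell_subdivisions_def)
qed

text \<open>The added edge is harmless away from the origin: a finite union of polytopes is closed,
  and each point of the right edge is a limit of covered points off that edge.\<close>

lemma Union_cell_subdivision:
  assumes pq: "(p, q) \<noteq> (0, 0)" and \<S>: "\<S> \<subseteq> cells p q"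
    and cover: "\<Union>\<S> \<union> cell p q p q = cell 0 0 p q"
  shows "\<Union>\<S> = cell 0 0 p q"
proof -
  have "finite \<S>" using \<S> finite_cells by (rule finite_subset)
  moreover have "closed P" if "P \<in> \<S>" for P
    using that \<S> by (auto elim!: cellsE intro!: polytope_imp_closed polytope_cell)
  ultimately have closed: "closed (\<Union>\<S>)" by blast
  have "z \<in> \<Union>\<S>" if z: "z \<in> cell p q p q" for z
  proof -
    \<comment> \<open>A corner on the left side that avoids the right edge; it exists because
      \<open>p\<close> and \<open>q\<close> are not both zero.\<close>
    obtain w where w: "w \<in> cell 0 0 p q" "w \<notin> cell p q p q"
    proof (cases "p = 0")
      case True
      then show thesis using that[of "(0, 1)"] pq by (simp add: mem_cell)
    next
      case False
      then show thesis using that[of "(0, 0)"] by (simp add: mem_cell)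
    qed
    have "cell p q p q face_of cell 0 0 p q"
      using edge_of_cell(1)[of 0 p 0 q] pq by (simp add: edge_of_def)
    have "open_segment w z \<subseteq> \<Union>\<S>"
    proof
      fix u assume u: "u \<in> open_segment w z"
      have "z \<in> cell 0 0 p q" using z cover by blast
      with u w have "u \<in> cell 0 0 p q"
        using convex_cell[of 0 p 0 q] by (meson convex_contains_open_segment subsetD zero_le)
      \<comment> \<open>An inner point of the segment lying in the face would force \<open>w\<close>
        into the face as well.\<close>
      moreover have "u \<notin> cell p q p q"
        using face_ofD[OF \<open>cell p q p q face_of _\<close> u] u w z cover by blast
      ultimately show "u \<in> \<Union>\<S>" using cover by blast
    qed
    then have "closure (open_segment w z) \<subseteq> \<Union>\<S>" using closed by (rule closure_minimal)
    moreover have "w \<noteq> z" using w z by blast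
    ultimately show "z \<in> \<Union>\<S>" by auto
  qed
  then show ?thesis using cover by blast
qed

text \<open>The arguments swap: \<open>two_row_grid\<close> takes the size of the top row first,
  while \<open>p\<close> is the last index of the bottom row.\<close>

lemma cell_subdivisions_eq:
  assumes "(p, q) \<noteq> (0, 0)"
  shows "{\<S>. is_subdivision (two_row_grid (Suc q) (Suc p)) \<S>} = cell_subdivisions p q"
proof -
  have "is_subdivision (two_row_grid (Suc q) (Suc p)) \<S> \<longleftrightarrow> \<S> \<in> cell_subdivisions p q" for \<S>
  proof -
    have "cell p q p q \<subseteq> cell 0 0 p q" by (simp add: cell_subset_iff)
    then show ?thesis
      unfolding is_subdivision_def cell_subdivisions_def polygon_iff_cells convex_hull_two_row_grid
      using Union_cell_subdivision[OF assms, of \<S>] by auto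
  qed
  then show ?thesis by blast
qed

section \<open>Adding and removing the last trapezoid\<close>

text \<open>The new cell fills exactly the region right of the segment \<open>(i, j)\<close>, and
  every older cell lies left of it.\<close>

lemma insert_cell_subdivision:
  assumes ij: "i \<le> p" "j \<le> q" "(i, j) \<noteq> (p, q)" and \<S>: "\<S> \<in> cell_subdivisions i j"
  shows "insert (cell i j p q) \<S> \<in> cell_subdivisions p q"
proof -
  let ?Q = "cell i j p q"
  have sub: "\<S> \<subseteq> cells i j" and cover: "\<Union>\<S> \<union> cell i j i j = cell 0 0 i j"
    and meet: "\<And>P Q. P \<in> \<S> \<Longrightarrow> Q \<in> \<S> \<Longrightarrow> P \<noteq> Q \<Longrightarrow> meet_properly P Q"
    using \<S> by (auto simp: cell_subdivisions_def)
  have "insert ?Q \<S> \<subseteq> cells p q"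
    using sub cells_mono[of i p j q] ij by (auto intro: cellsI)
  moreover have "\<Union>(insert ?Q \<S>) \<union> cell p q p q = cell 0 0 p q"
  proof -
    \<comment> \<open>The new cell absorbs both auxiliary edges, the old one and the new
      one.\<close>
    have "cell i j i j \<subseteq> ?Q" "cell p q p q \<subseteq> ?Q" using ij by (auto simp: cell_subset_iff)
    then have "\<Union>(insert ?Q \<S>) \<union> cell p q p q = ?Q \<union> (\<Union>\<S> \<union> cell i j i j)" by auto
    also have "\<dots> = ?Q \<union> cell 0 0 i j" by (simp only: cover)
    also have "\<dots> = cell 0 0 p q"
    proof
      show "?Q \<union> cell 0 0 i j \<subseteq> cell 0 0 p q" using ij by (simp add: cell_subset_iff)
      show "cell 0 0 p q \<subseteq> ?Q \<union> cell 0 0 i j" by (auto simp: mem_cell)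
    qed
    finally show ?thesis .
  qed
  moreover have "meet_properly P ?Q" if "P \<in> \<S>" for P
    using that sub ij by (auto elim!: cellsE intro!: meet_properly_cellI)
  ultimately show ?thesis
    using meet meet_properly_sym by (auto simp: cell_subdivisions_def)
qed

text \<open>The last polygon is found as one containing the midpoint of the right edge; its left
  edge is the segment \<open>(i, j)\<close>.\<close>

lemma cell_subdivision_remove_last:
  assumes pq: "(p, q) \<noteq> (0, 0)" and \<S>: "\<S> \<in> cell_subdivisions p q"
  obtains i j \<T> where "i \<le> p" "j \<le> q" "(i, j) \<noteq> (p, q)"
    "\<T> \<in> cell_subdivisions i j" "\<S> = insert (cell i j p q) \<T>"
proof -
  have sub: "\<S> \<subseteq> cells p q" and cover: "\<Union>\<S> \<union> cell p q p q = cell 0 0 p q"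
    and meet: "\<And>P Q. P \<in> \<S> \<Longrightarrow> Q \<in> \<S> \<Longrightarrow> P \<noteq> Q \<Longrightarrow> meet_properly P Q"
    using \<S> by (auto simp: cell_subdivisions_def)
  have "((real p + real q) / 2, 1/2) \<in> cell 0 0 p q"
    by (simp add: mem_cell crossing_def field_simps)
  then obtain Q where Q: "Q \<in> \<S>" "((real p + real q) / 2, 1/2) \<in> Q"
    using Union_cell_subdivision[OF pq sub cover] by blast
  then have "Q \<in> cells p q" using sub by blast
  then obtain i j b d where Qc: "Q = cell i j b d"
    and *: "i \<le> b" "b \<le> p" "j \<le> d" "d \<le> q" "(i, j) \<noteq> (b, d)" by (rule cellsE)
  \<comment> \<open>Containing the midpoint bounds \<open>b + d\<close> from below; with
    \<open>b \<le> p\<close> and \<open>d \<le> q\<close> both bounds are attained.\<close>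
  have "real p + real q \<le> real b + real d"
    using Q(2) by (simp add: Qc mem_cell crossing_def field_simps)
  then have bd: "b = p" "d = q" using * by linarith+
  have ij: "i \<le> p" "j \<le> q" "(i, j) \<noteq> (p, q)" using * bd by auto
  have Qc: "Q = cell i j p q" using Qc bd by simp
  define \<T> where "\<T> = \<S> - {Q}"
  have subT: "\<T> \<subseteq> cells i j"
  proof
    fix P assume "P \<in> \<T>"
    then have P: "P \<in> cells p q" and PQ: "meet_properly P Q"
      using sub meet Q by (auto simp: \<T>_def)
    from P obtain a c b d where P: "P = cell a c b d"
      and *: "a \<le> b" "b \<le> p" "c \<le> d" "d \<le> q" "(a, c) \<noteq> (b, d)" by (rule cellsE)
    have "b \<le> i \<and> d \<le> j"
      using meet_properly_cell_left[of a b c d p q i j] * ij PQ by (simp add: P Qc)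
    then show "P \<in> cells i j" unfolding P using * by (intro cellsI) auto
  qed
  have "\<Union>\<T> \<union> cell i j i j = cell 0 0 i j"
  proof
    have "P \<subseteq> cell 0 0 i j" if "P \<in> \<T>" for P
    proof -
      have "P \<in> cells i j" using that subT by blast
      then show ?thesis by (rule cellsE) (simp add: cell_subset_iff)
    qed
    then show "\<Union>\<T> \<union> cell i j i j \<subseteq> cell 0 0 i j" by (auto simp: cell_subset_iff)
    show "cell 0 0 i j \<subseteq> \<Union>\<T> \<union> cell i j i j"
    proof
      fix z assume z: "z \<in> cell 0 0 i j"
      then have "z \<in> cell 0 0 p q" using ij cell_subset_iff[of 0 i 0 j 0 p 0 q] by blast
      then have "z \<in> \<Union>\<T> \<or> z \<in> Q"
        using Union_cell_subdivision[OF pq sub cover] by (auto simp: \<T>_def)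
      \<comment> \<open>Points of the last cell that lie in the remaining region are on the shared
        edge, which is exactly the edge added to the union.\<close>
      moreover have "z \<in> cell i j i j" if "z \<in> Q"
        using that z by (auto simp: Qc cell_def)
      ultimately show "z \<in> \<Union>\<T> \<union> cell i j i j" by blast
    qed
  qed
  then have "\<T> \<in> cell_subdivisions i j"
    using subT meet by (auto simp: cell_subdivisions_def \<T>_def)
  moreover have "\<S> = insert (cell i j p q) \<T>" using Q Qc by (auto simp: \<T>_def)
  ultimately show thesis using that ij by blast
qed

text \<open>Members of the family stay left of the segment \<open>(i, j)\<close>, so none reaches
  \<open>(p, q)\<close>. This yields both disjointness and injectivity in the count below.\<close>

lemma last_cell_unique:
  assumes "i \<le> p" "j \<le> q" "(i, j) \<noteq> (p, q)" "\<S> \<in> cell_subdivisions i j" "k \<le> p" "l \<le> q"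
  shows "cell k l p q \<notin> \<S>"
proof
  assume "cell k l p q \<in> \<S>"
  then have "cell k l p q \<subseteq> cell 0 0 i j"
    using assms by (auto simp: cell_subdivisions_def)
  then show False using assms by (simp add: cell_subset_iff)
qed

section \<open>Counting and the recurrence\<close>

text \<open>The subdivisions split into disjoint classes according to the left edge
  \<open>(i, j)\<close> of the last polygon; removing that polygon is a bijection from each class to
  \<open>cell_subdivisions i j\<close>.\<close>

lemma card_cell_subdivisions:
  assumes pq: "(p, q) \<noteq> (0, 0)"
  shows "card (cell_subdivisions p q) =
    (\<Sum>(i, j)\<in>{..p} \<times> {..q} - {(p, q)}. card (cell_subdivisions i j))"
proof -
  define I where "I = {..p} \<times> {..q} - {(p, q)}"
  define F where "F = (\<lambda>(i, j). insert (cell i j p q) ` cell_subdivisions i j)"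
  have "cell_subdivisions p q = (\<Union>(F ` I))"
  proof
    show "cell_subdivisions p q \<subseteq> (\<Union>(F ` I))"
    proof
      fix \<S> assume "\<S> \<in> cell_subdivisions p q"
      then obtain i j \<T> where *: "i \<le> p" "j \<le> q" "(i, j) \<noteq> (p, q)"
        "\<T> \<in> cell_subdivisions i j" "\<S> = insert (cell i j p q) \<T>"
        by (rule cell_subdivision_remove_last[OF pq])
      then have "(i, j) \<in> I" "\<S> \<in> F (i, j)" by (auto simp: I_def F_def)
      then show "\<S> \<in> (\<Union>(F ` I))" by blast
    qed
    show "(\<Union>(F ` I)) \<subseteq> cell_subdivisions p q"
      by (auto simp: I_def F_def intro!: insert_cell_subdivision)
  qed
  also have "card \<dots> = (\<Sum>z\<in>I. card (F z))"
  proof (rule card_UN_disjoint)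
    show "finite I" by (simp add: I_def)
    show "\<forall>z\<in>I. finite (F z)" by (auto simp: F_def finite_cell_subdivisions)
    show "\<forall>z\<in>I. \<forall>w\<in>I. z \<noteq> w \<longrightarrow> F z \<inter> F w = {}"
    proof (intro ballI impI)
      fix z w assume zw: "z \<in> I" "w \<in> I" "z \<noteq> w"
      obtain i j k l where ij: "z = (i, j)" "w = (k, l)" by (meson surj_pair)
      with zw have I: "(i, j) \<in> I" "(k, l) \<in> I" and ne: "(i, j) \<noteq> (k, l)" by auto
      have False if "\<S> \<in> cell_subdivisions i j" "\<T> \<in> cell_subdivisions k l"
        "insert (cell i j p q) \<S> = insert (cell k l p q) \<T>" for \<S> \<T>
      proof -
        have "cell k l p q \<notin> \<S>" using I that by (intro last_cell_unique) (auto simp: I_def)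
        \<comment> \<open>The last cell of one family is not an older member of the other, so the
          two last cells coincide.\<close>
        then have "cell k l p q = cell i j p q" using that(3) by blast
        then show False
          using I ne cell_subset_iff[of k p l q i p j q] cell_subset_iff[of i p j q k p l q]
          by (simp add: I_def)
      qed
      then show "F z \<inter> F w = {}" by (auto simp: F_def ij)
    qed
  qed
  also have "\<dots> = (\<Sum>(i, j)\<in>I. card (cell_subdivisions i j))"
  proof (rule sum.cong)
    fix z assume "z \<in> I"
    then obtain i j where z: "z = (i, j)" "i \<le> p" "j \<le> q" "(i, j) \<noteq> (p, q)"
      by (auto simp: I_def)
    have "inj_on (insert (cell i j p q)) (cell_subdivisions i j)"
      using z last_cell_unique[of i p j q] by (intro inj_onI) (meson insert_ident)
    then show "card (F z) = (case z of (i, j) \<Rightarrow> card (cell_subdivisions i j))"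
      by (simp add: F_def z card_image)
  qed simp
  finally show ?thesis by (simp add: I_def)
qed

text \<open>All terms but the one at \<open>(p, q)\<close> add up to that term, so the full sum is
  twice it. At the origin the sum is 1, and its half is the conventional value.\<close>

lemma num_subdivisions_eq_sum:
  "num_subdivisions (Suc q) (Suc p) =
    (\<Sum>i\<le>p. \<Sum>j\<le>q. real (card (cell_subdivisions i j))) / 2"
proof (cases "(p, q) = (0, 0)")
  case True
  then show ?thesis by (simp add: num_subdivisions_def cell_subdivisions_0)
next
  case False
  have "(\<Sum>i\<le>p. \<Sum>j\<le>q. card (cell_subdivisions i j)) =
      (\<Sum>(i, j)\<in>{..p} \<times> {..q}. card (cell_subdivisions i j))"
    by (simp add: sum.cartesian_product)
  also have "\<dots> = 2 * card (cell_subdivisions p q)"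
    by (subst sum.remove[of _ "(p, q)"]) (simp_all add: card_cell_subdivisions[OF False])
  finally have "real (\<Sum>i\<le>p. \<Sum>j\<le>q. card (cell_subdivisions i j)) =
      2 * real (card (cell_subdivisions p q))"
    by simp
  then show ?thesis using False cell_subdivisions_eq[OF False] by (auto simp: num_subdivisions_def)
qed

theorem lemma2:
  fixes m n :: nat
  assumes "m \<ge> 2" and "n \<ge> 2"
  shows "num_subdivisions m n =
    2 * num_subdivisions m (n - 1) + 2 * num_subdivisions (m - 1) n
    - 2 * num_subdivisions (m - 1) (n - 1)"
proof -
  obtain p q where n: "n = Suc (Suc p)" and m: "m = Suc (Suc q)"
    using assms that[of "n - 2" "m - 2"] by simp
  have "num_subdivisions m n = real (card (cell_subdivisions (Suc p) (Suc q)))"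
    using cell_subdivisions_eq[of "Suc p" "Suc q"] by (simp add: num_subdivisions_def m n)
  \<comment> \<open>Inclusion-exclusion over the rectangle of indices leaves the corner term, which
    is half of \<open>num_subdivisions m n\<close>; moving it to the left produces the factors
    2.\<close>
  moreover have "num_subdivisions m n =
      num_subdivisions (Suc q) n + num_subdivisions m (Suc p) - num_subdivisions (Suc q) (Suc p)
      + real (card (cell_subdivisions (Suc p) (Suc q))) / 2"
    by (simp add: num_subdivisions_eq_sum m n sum.distrib add_divide_distrib)
  ultimately show ?thesis by (simp add: m n)
qed

end
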